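(* Let $t\ge 2$ be an integer, and let $A\subset\mathbb{N}$ be an extremal finite set with $|A|=t$. Set $S=S(n(A),A)$, i.e. $S=\bigl(\{x\in\mathbb{N}\mid x\ge n(A)\}\cup\{0\}\bigr)\setminus\{(2n(A)-1)-a\mid a\in A\}$. Then $S$ is a numerical semigroup and the following hold: (1) $S$ is far-flung Gorenstein; (2) $s(S)=t(S)=t$; (3) $m(S)=\overline{n}(t(S))$. (In particular, for every integer $t\ge2$ there exists a far-flung Gorenstein numerical semigroup $S$ with $t(S)=t$ and $m(S)=\overline{n}(t(S))$.)
   Context: $\mathbb{N}$ denotes the non-negative integers. For integers $x\le y$, $[x,y]=\{z\in\mathbb{Z}\mid x\le z\le y\}$. For sets of integers, $A+B=\{a+b\mid a\in A,b\in B\}$ and $I-J=\{z\in\mathbb{Z}\mid z+y\in I\text{ for all }y\in J\}$ (reserved for relative ideals; set difference is written $\setminus$). A numerical semigroup is a submonoid $S$ of $(\mathbb{N},+)$ with $\mathbb{N}\setminus S$ finite. Its multiplicity $m(S)$ is the smallest element of $S\setminus\{0\}$; its Frobenius number $F(S)$ is the largest integer in $\mathbb{Z}\setminus S$. The set of pseudo-Frobenius numbers is $PF(S)=\{x\in\mathbb{Z}\setminus S\mid x+s\in S\text{ for all }0\ne s\in S\}$, and the type is $t(S)=|PF(S)|$. Put $rPF(S)=[F(S)-m(S)+1,F(S)]\setminus S$ (a subset of $PF(S)$); the reduced type is $s(S)=|rPF(S)|$. Let $C(S)=\{z\in\mathbb{Z}\mid z\ge F(S)+1\}$, $K(S)=\{x\in\mathbb{Z}\mid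 F(S)-x\notin S\}$, and $\mathrm{tr}(K(S))=K(S)+(S-K(S))$. $S$ is far-flung Gorenstein if $\mathrm{tr}(K(S))=C(S)$. For a finite set $A\subset\mathbb{N}$ with $0\in A$, $n(A)$ is the integer such that $0,1,\dots,n(A)-1\in A+A$ and $n(A)\notin A+A$; if $0\notin A$, $n(A)=-1$. For a positive integer $t$, $\overline{n}(t)=\max\{n(A)\mid A\subset\mathbb{N},\ |A|=t\}$. A finite set $A\subset\mathbb{N}$ is extremal if $n(A)=\overline{n}(|A|)$. *)

theory Defs
  imports Main "HOL-Library.Set_Algebras"
begin

text \<open>
  Numerical semigroups are represented as sets of integers contained in the non-negative integers,
  since pseudo-Frobenius numbers and relative ideals may contain negative integers.
  On sets, \<open>A + B\<close> is the Minkowski sum and \<open>A - B\<close> is set difference.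
\<close>

definition numerical_semigroup :: "int set \<Rightarrow> bool" where
  "numerical_semigroup S \<longleftrightarrow>
     S \<subseteq> {0..} \<and> 0 \<in> S \<and> (\<forall>x\<in>S. \<forall>y\<in>S. x + y \<in> S) \<and> finite ({0..} - S)"

definition multiplicity :: "int set \<Rightarrow> int" where
  "multiplicity S = (LEAST x. x \<in> S - {0})"

definition frobenius :: "int set \<Rightarrow> int" where
  "frobenius S = (GREATEST x. x \<notin> S)"

definition PF :: "int set \<Rightarrow> int set" where
  "PF S = {x. x \<notin> S \<and> (\<forall>s\<in>S. s \<noteq> 0 \<longrightarrow> x + s \<in> S)}"

definition semigroup_type :: "int set \<Rightarrow> nat" where
  "semigroup_type S = card (PF S)"

definition rPF :: "int set \<Rightarrow> int set" where
  "rPF S = {frobenius S - multiplicity S + 1 .. frobenius S} - S"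

definition reduced_type :: "int set \<Rightarrow> nat" where
  "reduced_type S = card (rPF S)"

definition conductor_ideal :: "int set \<Rightarrow> int set" where
  "conductor_ideal S = {z. z \<ge> frobenius S + 1}"

definition canonical_ideal :: "int set \<Rightarrow> int set" where
  "canonical_ideal S = {x. frobenius S - x \<notin> S}"

definition ideal_diff :: "int set \<Rightarrow> int set \<Rightarrow> int set" where
  "ideal_diff I J = {z. \<forall>y\<in>J. z + y \<in> I}"

definition trace_ideal :: "int set \<Rightarrow> int set \<Rightarrow> int set" where
  "trace_ideal S I = I + ideal_diff S I"

definition far_flung_gorenstein :: "int set \<Rightarrow> bool" where
  "far_flung_gorenstein S \<longleftrightarrow> trace_ideal S (canonical_ideal S) = conductor_ideal S"

text \<open>
  The number \<open>n(A)\<close>: the first natural number that is not a sum of two elements of \<open>A\<close>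
  if \<open>0 \<in> A\<close>, and \<open>-1\<close> otherwise. It is meant for finite \<open>A\<close> only.
\<close>

definition sum_range :: "nat set \<Rightarrow> int" where
  "sum_range A =
     (if 0 \<in> A then int (THE n. (\<forall>k<n. k \<in> A + A) \<and> n \<notin> A + A) else -1)"

definition max_sum_range :: "nat \<Rightarrow> int" where
  "max_sum_range t = Max {sum_range A |A. finite A \<and> card A = t}"

definition extremal :: "nat set \<Rightarrow> bool" where
  "extremal A \<longleftrightarrow> finite A \<and> sum_range A = max_sum_range (card A)"

definition semigroup_of :: "int \<Rightarrow> nat set \<Rightarrow> int set" where
  "semigroup_of m A = ({x. 0 \<le> x \<and> m \<le> x} \<union> {0}) - {(2 * m - 1) - int a |a. a \<in> A}"

text \<open>The description of \<open>n(A)\<close> is unique, and the maximum is over a finite nonempty set.\<close>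

lemma sum_range_unique:
  fixes A :: "nat set"
  assumes "finite A"
  shows "\<exists>!n. (\<forall>k<n. k \<in> A + A) \<and> n \<notin> A + A"
proof -
  have "finite (A + A)"
    using assms by (intro finite_set_plus)
  then obtain m where "m \<notin> A + A"
    using ex_new_if_finite[OF infinite_UNIV_nat] by blast
  then have n: "(LEAST n. n \<notin> A + A) \<notin> A + A"
    by (rule LeastI)
  have k: "\<forall>k<(LEAST n. n \<notin> A + A). k \<in> A + A"
    using not_less_Least by blast
  show ?thesis
  proof (rule ex1I)
    show "(\<forall>k<(LEAST n. n \<notin> A + A). k \<in> A + A) \<and> (LEAST n. n \<notin> A + A) \<notin> A + A"
      using k n by (rule conjI)
  next
    fix m
    assume m: "(\<forall>k<m. k \<in> A + A) \<and> m \<notin> A + A"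
    show "m = (LEAST n. n \<notin> A + A)"
      using m k n by (cases m "LEAST n. n \<notin> A + A" rule: linorder_cases) blast+
  qed
qed

lemma sum_range_le:
  assumes "finite A"
  shows "sum_range A \<le> int (card A * card A)"
proof (cases "0 \<in> A")
  case True
  define n where "n = (THE n. (\<forall>k<n. k \<in> A + A) \<and> n \<notin> A + A)"
  have "{..<n} \<subseteq> A + A"
    using theI'[OF sum_range_unique[OF assms]] unfolding n_def by blast
  also have "A + A = (\<lambda>(a, b). a + b) ` (A \<times> A)"
    by (simp add: set_plus_image)
  finally have "card {..<n} \<le> card (A \<times> A)"
    using assms by (intro surj_card_le) auto
  then have "n \<le> card A * card A"
    by (simp add: card_cartesian_product)
  then show ?thesis
    using True by (simp add: sum_range_def n_def flip: of_nat_mult)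
next
  case False
  then have "sum_range A = -1"
    by (simp add: sum_range_def)
  then show ?thesis
    by linarith
qed

lemma sum_range_values:
  "finite {sum_range A |A. finite A \<and> card A = t}" "{sum_range A |A. finite A \<and> card A = t} \<noteq> {}"
proof -
  have "sum_range A \<in> {-1..int (t * t)}" if "finite A" "card A = t" for A
    using sum_range_le[OF that(1)] that(2) by (simp add: sum_range_def)
  then have "{sum_range A |A. finite A \<and> card A = t} \<subseteq> {-1..int (t * t)}"
    by blast
  then show "finite {sum_range A |A. finite A \<and> card A = t}"
    by (rule finite_subset) simp
  have "finite {..<t} \<and> card {..<t} = t"
    by simp
  then show "{sum_range A |A. finite A \<and> card A = t} \<noteq> {}"
    by blast
qed

end

(*
  Let n = n(A).  Extremality is used only to get n \<ge> 2 and A \<subseteq> {0,...,n-1}: an element a > n of A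
  could be exchanged for n, which would make n(A) larger.  Then F(S) = 2n-1, m(S) = n, and
  K(S) is a set of non-negative integers containing A.
  For z = 2n-1-b in S with b < n write b = a + a' with a, a' in A; then z + a = 2n-1-a' is a gap,
  so S - K(S) contains no element below 2n.
  A pseudo-Frobenius number x with 0 < x < n would make A closed under a \<mapsto> a + x below n, and
  adding x to a representation of n - x in A + A would represent n.
*)
theory Submission
  imports Defs
begin

section \<open>Bounds for n(A) and its maximum\<close>

lemma sum_range_cases:
  assumes "finite A" "0 \<in> A"
  obtains n where "sum_range A = int n" "\<And>k. k < n \<Longrightarrow> k \<in> A + A" "n \<notin> A + A"
proof (rule that)
  show "sum_range A = int (THE n. (\<forall>k<n. k \<in> A + A) \<and> n \<notin> A + A)"
    using assms(2) by (simp add: sum_range_def)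
qed (use theI'[OF sum_range_unique[OF assms(1)]] in blast)+

text \<open>Lower bounds on n(A) need only an initial segment of \<open>A + A\<close>; the exact
  value is never computed.\<close>

lemma less_sum_range:
  assumes "finite A" "0 \<in> A" "\<And>k. k \<le> n \<Longrightarrow> k \<in> A + A"
  shows "int n < sum_range A"
  using sum_range_cases[OF assms(1,2)] assms(3) by (metis linorder_not_less of_nat_less_iff)

lemma sum_range_le_max:
  "finite A \<Longrightarrow> sum_range A \<le> max_sum_range (card A)"
  unfolding max_sum_range_def by (rule Max_ge[OF sum_range_values(1)]) blast

lemma max_sum_range_attained:
  obtains A where "extremal A" "card A = t"
proof -
  have "max_sum_range t \<in> {sum_range A |A. finite A \<and> card A = t}"
    unfolding max_sum_range_def by (rule Max_in[OF sum_range_values])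
  then obtain A where "finite A" "card A = t" "sum_range A = max_sum_range t"
    unfolding mem_Collect_eq by metis
  then show thesis
    using that[of A] by (simp add: extremal_def)
qed

text \<open>The witness \<open>{..<t}\<close> contains 0 and 1, which are sums with second summand
  0.\<close>

lemma max_sum_range_ge_2:
  assumes "t \<ge> 2"
  shows "2 \<le> max_sum_range t"
proof -
  have "int 1 < sum_range {..<t}"
  proof (rule less_sum_range)
    show "k \<in> {..<t} + {..<t}" if "k \<le> 1" for k
      using assms that by (intro set_plus_intro[of k _ 0, simplified]) auto
  qed (use assms in auto)
  then show ?thesis
    using sum_range_le_max[of "{..<t}"] by simp
qed

text \<open>Separates the semigroup argument from extremality. The last two assumptions say that
  n(A) is \<open>n\<close>; that 0 lies in \<open>A\<close> follows from 0 being covered.\<close>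

locale short_basis =
  fixes A :: "nat set" and n :: nat
  assumes ge_2: "n \<ge> 2"
    and subset: "A \<subseteq> {..<n}"
    and covered: "k < n \<Longrightarrow> k \<in> A + A"
    and not_covered: "n \<notin> A + A"
begin

lemma coveredE:
  assumes "k < n"
  obtains a b where "a \<in> A" "b \<in> A" "k = a + b"
  using covered[OF assms] by (auto elim: set_plus_elim)

lemma sum_neq: "a \<in> A \<Longrightarrow> b \<in> A \<Longrightarrow> a + b \<noteq> n"
  using not_covered by (auto intro: set_plus_intro)

lemma zero_in: "0 \<in> A"
  using coveredE[of 0] ge_2 by auto

lemma one_in: "1 \<in> A"
proof -
  obtain a b where "a \<in> A" "b \<in> A" "1 = a + b"
    using coveredE[of 1] ge_2 by auto
  then show ?thesis
    by (cases a) auto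
qed

text \<open>Since 1 is in \<open>A\<close>, having \<open>n - 1\<close> in \<open>A\<close> would
  represent \<open>n\<close>. The bound puts every removed number 2n-1-a strictly above
  \<open>n\<close>, so \<open>n\<close> stays in \<open>S\<close>.\<close>

lemma less_n: "a \<in> A \<Longrightarrow> a < n - 1"
  using subset sum_neq[of a 1] one_in by fastforce

section \<open>The semigroup: membership, multiplicity and Frobenius number\<close>

abbreviation S :: "int set" where
  "S \<equiv> semigroup_of (int n) A"

text \<open>Each a in \<open>A\<close> is below \<open>n\<close>, so 2n-1-a is positive and the set
  difference never removes 0.\<close>

lemma mem_S_iff:
  "x \<in> S \<longleftrightarrow> x = 0 \<or> int n \<le> x \<and> (\<forall>a\<in>A. x \<noteq> 2 * int n - 1 - int a)"
  using subset ge_2 by (fastforce simp: semigroup_of_def)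

lemma gap_notin: "a \<in> A \<Longrightarrow> 2 * int n - 1 - int a \<notin> S"
  using less_n[of a] by (auto simp: mem_S_iff)

lemma large_in: "2 * int n \<le> x \<Longrightarrow> x \<in> S"
  by (auto simp: mem_S_iff)

lemma S_ge: "x \<in> S \<Longrightarrow> x \<noteq> 0 \<Longrightarrow> int n \<le> x"
  by (auto simp: mem_S_iff)

lemma numerical_semigroup_S: "numerical_semigroup S"
  unfolding numerical_semigroup_def
proof (intro conjI ballI)
  \<comment> \<open>Two nonzero elements are at least \<open>n\<close> each, so their sum is past
    the last gap 2n-1.\<close>
  show "x + y \<in> S" if "x \<in> S" "y \<in> S" for x y
    using that S_ge[of x] S_ge[of y] large_in[of "x + y"] by (cases "x = 0"; cases "y = 0") auto
  have "{0..} - S \<subseteq> {0..<2 * int n}"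
    by (auto simp: mem_S_iff)
  then show "finite ({0..} - S)"
    using finite_subset by blast
qed (auto simp: mem_S_iff)

lemma multiplicity_S: "multiplicity S = int n"
  unfolding multiplicity_def
proof (rule Least_equality)
  have "int n \<noteq> 2 * int n - 1 - int a" if "a \<in> A" for a
    using less_n[OF that] by linarith
  then show "int n \<in> S - {0}"
    using ge_2 by (simp add: mem_S_iff)
qed (use S_ge in auto)

lemma frobenius_S: "frobenius S = 2 * int n - 1"
  unfolding frobenius_def
proof (rule Greatest_equality)
  show "2 * int n - 1 \<notin> S"
    using gap_notin[OF zero_in] by simp
  show "x \<le> 2 * int n - 1" if "x \<notin> S" for x
    using that large_in[of x] by linarith
qed

section \<open>Pseudo-Frobenius numbers and the two types\<close>

lemma rPF_S: "rPF S = (\<lambda>a. 2 * int n - 1 - int a) ` A"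
  using gap_notin less_n ge_2 unfolding rPF_def frobenius_S multiplicity_S
  by (fastforce simp: mem_S_iff)

lemma PF_S_ge:
  assumes "x \<in> PF S"
  shows "int n \<le> x"
proof (rule ccontr)
  assume "\<not> int n \<le> x"
  have notin: "x \<notin> S" and add: "\<And>s. s \<in> S \<Longrightarrow> s \<noteq> 0 \<Longrightarrow> x + s \<in> S"
    using assms by (auto simp: PF_def)
  have "x > 0"
  proof (rule ccontr)
    assume "\<not> x > 0"
    with notin have "x < 0"
      by (cases "x = 0") (auto simp: mem_S_iff)
    \<comment> \<open>For negative \<open>x\<close>, the element 2n-1-x is at least 2n, hence in
      \<open>S\<close>, but adding \<open>x\<close> to it gives the gap 2n-1.\<close>
    then have "x + (2 * int n - 1 - x) \<in> S"
      using ge_2 by (intro add large_in) auto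
    then show False
      using gap_notin[OF zero_in] by simp
  qed
  define y where "y = nat x"
  have y: "x = int y" "0 < y" "y < n"
    using \<open>x > 0\<close> \<open>\<not> int n \<le> x\<close> by (auto simp: y_def)
  \<comment> \<open>Otherwise 2n-1-(a+y) is a nonzero element of \<open>S\<close>, and adding
    \<open>x\<close> turns it into the gap 2n-1-a.\<close>
  have closed: "a + y \<in> A" if "a \<in> A" "a + y < n" for a
  proof (rule ccontr)
    assume "a + y \<notin> A"
    have "2 * int n - 1 - int (a + y) \<noteq> 2 * int n - 1 - int b" if "b \<in> A" for b
      using that \<open>a + y \<notin> A\<close> by (auto simp flip: of_nat_add)
    then have "2 * int n - 1 - int (a + y) \<in> S"
      using that(2) unfolding mem_S_iff by auto
    then have "x + (2 * int n - 1 - int (a + y)) \<in> S"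
      using that(2) by (intro add) auto
    then show False
      using gap_notin[OF that(1)] by (simp add: y algebra_simps)
  qed
  obtain a b where ab: "a \<in> A" "b \<in> A" "n - y = a + b"
    using coveredE[of "n - y"] y by auto
  show False
  proof (cases "a + y < n")
    case True
    then show False
      using sum_neq[OF closed[OF ab(1)] ab(2)] ab(3) y by simp
  next
    case False
    \<comment> \<open>From a <= n-y the sum cannot exceed \<open>n\<close>. In this boundary case
      \<open>closed\<close> is applied to 0 instead: it puts \<open>y\<close> itself in
      \<open>A\<close>.\<close>
    then have "a + y = n"
      using ab(3) y by linarith
    then show False
      using sum_neq[OF ab(1) closed[OF zero_in]] y by simp
  qed
qed

text \<open>Both sides consist of the gaps that are at least \<open>n\<close>: such a gap plus a
  nonzero element of \<open>S\<close> is at least 2n.\<close>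

lemma PF_S: "PF S = rPF S"
proof
  show "PF S \<subseteq> rPF S"
  proof
    fix x assume x: "x \<in> PF S"
    then have "x \<notin> S"
      by (simp add: PF_def)
    moreover from this have "x < 2 * int n"
      using large_in by (meson linorder_not_less)
    ultimately show "x \<in> rPF S"
      using PF_S_ge[OF x] by (simp add: rPF_def frobenius_S multiplicity_S)
  qed
  show "rPF S \<subseteq> PF S"
    using S_ge large_in by (fastforce simp: rPF_def PF_def frobenius_S multiplicity_S)
qed

lemma card_rPF_S: "card (rPF S) = card A"
  unfolding rPF_S by (rule card_image) (auto simp: inj_on_def)

section \<open>The canonical ideal and its trace\<close>

lemma A_subset_canonical: "a \<in> A \<Longrightarrow> int a \<in> canonical_ideal S"
  using gap_notin by (simp add: canonical_ideal_def frobenius_S)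

lemma canonical_nonneg: "x \<in> canonical_ideal S \<Longrightarrow> 0 \<le> x"
  using large_in[of "2 * int n - 1 - x"] by (force simp: canonical_ideal_def frobenius_S)

lemma ideal_diff_canonical: "ideal_diff S (canonical_ideal S) = {2 * int n..}"
proof (intro equalityI subsetI)
  fix z assume "z \<in> ideal_diff S (canonical_ideal S)"
  then have add: "z + int a \<in> S" if "a \<in> A" for a
    using A_subset_canonical[OF that] by (auto simp: ideal_diff_def)
  have "z \<in> S"
    using add[OF zero_in] by simp
  \<comment> \<open>As 1 is in \<open>A\<close>, z = 0 would put 1 in \<open>S\<close>, against n >=
    2.\<close>
  moreover have "z \<noteq> 0"
    using add[OF one_in] S_ge[of 1] ge_2 by auto
  ultimately have z: "int n \<le> z"
    by (rule S_ge)
  show "z \<in> {2 * int n..}"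
  proof (rule ccontr)
    assume "z \<notin> {2 * int n..}"
    then have less: "nat (2 * int n - 1 - z) < n" and nonneg: "2 * int n - 1 - z \<ge> 0"
      using z by auto
    obtain a b where "a \<in> A" "b \<in> A" and ab: "nat (2 * int n - 1 - z) = a + b"
      using coveredE[OF less] .
    have "z + int a = 2 * int n - 1 - int b"
      using ab nonneg by linarith
    then show False
      using add[OF \<open>a \<in> A\<close>] gap_notin[OF \<open>b \<in> A\<close>] by simp
  qed
next
  fix z assume "z \<in> {2 * int n..}"
  then show "z \<in> ideal_diff S (canonical_ideal S)"
    using canonical_nonneg by (force simp: ideal_diff_def intro: large_in)
qed

text \<open>K(S) is non-negative and contains 0, so adding it leaves the ray from 2n = F(S)+1
  unchanged.\<close>

lemma far_flung_gorenstein_S: "far_flung_gorenstein S"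
proof -
  have "canonical_ideal S + {2 * int n..} = {2 * int n..}"
  proof (intro equalityI subsetI)
    show "x \<in> {2 * int n..}" if "x \<in> canonical_ideal S + {2 * int n..}" for x
      using that canonical_nonneg by (force elim!: set_plus_elim)
    show "x \<in> canonical_ideal S + {2 * int n..}" if "x \<in> {2 * int n..}" for x
      using set_plus_intro[OF A_subset_canonical[OF zero_in] that] by simp
  qed
  then show ?thesis
    unfolding far_flung_gorenstein_def trace_ideal_def ideal_diff_canonical
    by (auto simp: conductor_ideal_def frobenius_S)
qed

end

section \<open>From extremal sets to the locale assumptions\<close>

lemma extremal_short_basis:
  assumes "extremal A" "card A \<ge> 2"
  obtains n where "sum_range A = int n" "short_basis A n"
proof -
  have fin: "finite A" and max: "sum_range A = max_sum_range (card A)"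
    using assms(1) by (auto simp: extremal_def)
  have ge: "2 \<le> sum_range A"
    using max_sum_range_ge_2[OF assms(2)] max by simp
  \<comment> \<open>The default value -1 for sets without 0 is ruled out by
    \<open>ge\<close>.\<close>
  then have zero: "0 \<in> A"
    by (auto simp: sum_range_def split: if_splits)
  obtain n where n: "sum_range A = int n" "\<And>k. k < n \<Longrightarrow> k \<in> A + A" "n \<notin> A + A"
    using sum_range_cases[OF fin zero] by metis
  have "n \<notin> A"
    using n(3) set_plus_intro[OF _ zero, of n] by auto
  have "a < n" if "a \<in> A" for a
  proof (rule ccontr)
    assume "\<not> a < n"
    with that \<open>n \<notin> A\<close> have "n < a"
      by (cases "a = n") auto
    \<comment> \<open>Sums below \<open>n\<close> cannot involve \<open>a\<close>, so they survive
      the exchange, while n = n + 0 becomes a new sum.\<close>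
    let ?B = "insert n (A - {a})"
    have "card ?B = card A"
      using fin that \<open>n \<notin> A\<close> by (metis Diff_iff card_Suc_Diff1 card_insert_disjoint finite_Diff)
    moreover have "int n < sum_range ?B"
    proof (rule less_sum_range)
      show zero': "0 \<in> ?B"
        using zero \<open>n < a\<close> by auto
      show "k \<in> ?B + ?B" if k: "k \<le> n" for k
      proof (cases "k = n")
        case True
        then show ?thesis
          using set_plus_intro[OF _ zero', of n ?B] by simp
      next
        case False
        then obtain b c where "b \<in> A" "c \<in> A" "k = b + c"
          using n(2)[of k] k by (auto elim: set_plus_elim)
        moreover have "b \<noteq> a" "c \<noteq> a"
          using \<open>k = b + c\<close> \<open>k \<le> n\<close> \<open>n < a\<close> by auto
        ultimately show ?thesis
          by (auto intro: set_plus_intro)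
      qed
    qed (use fin in simp)
    ultimately show False
      using sum_range_le_max[of ?B] fin max n(1) by simp
  qed
  then have "short_basis A n"
    using n ge by unfold_locales auto
  with n(1) show thesis
    by (rule that)
qed

theorem theorem2:
  fixes t :: nat
  assumes "t \<ge> 2"
  shows "(\<forall>A S. extremal A \<and> card A = t \<and> S = semigroup_of (sum_range A) A \<longrightarrow>
            numerical_semigroup S \<and>
            far_flung_gorenstein S \<and>
            reduced_type S = semigroup_type S \<and> semigroup_type S = t \<and>
            multiplicity S = max_sum_range (semigroup_type S)) \<and>
         (\<exists>S. numerical_semigroup S \<and> far_flung_gorenstein S \<and>
            semigroup_type S = t \<and> multiplicity S = max_sum_range (semigroup_type S))"
    (is "(\<forall>A S. ?hyp A S \<longrightarrow> ?concl S) \<and> _")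
proof
  show all: "\<forall>A S. ?hyp A S \<longrightarrow> ?concl S"
  proof (intro allI impI)
    fix A T
    assume hyp: "?hyp A T"
    then obtain n where n: "sum_range A = int n" "short_basis A n"
      using extremal_short_basis[of A] assms by auto
    interpret short_basis A n
      by (rule n(2))
    have T: "T = S"
      using hyp n(1) by simp
    have "semigroup_type T = t" "reduced_type T = t"
      using card_rPF_S hyp by (auto simp: T n(1) semigroup_type_def reduced_type_def PF_S)
    moreover have "multiplicity T = max_sum_range t"
      using hyp n(1) multiplicity_S by (simp add: T extremal_def)
    ultimately show "?concl T"
      using numerical_semigroup_S far_flung_gorenstein_S by (simp add: T)
  qed
  \<comment> \<open>Existence follows from the first part, because the maximum is attained.\<close>
  obtain A where "extremal A" "card A = t"
    by (rule max_sum_range_attained)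
  with all show "\<exists>S. numerical_semigroup S \<and> far_flung_gorenstein S \<and>
      semigroup_type S = t \<and> multiplicity S = max_sum_range (semigroup_type S)"
    by blast
qed

end
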